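(* Let $X$ be a Banach space and $H\in\Gamma(X)$. Consider the following statements: (i) $H$ is totally convex at each point of $\operatorname{dom}\partial H$; (ii) $H$ is essentially firmly subdifferentiable; (iii) $H$ is essentially strongly convex; (iv) $H$ is essentially strictly convex. Then (i) $\Rightarrow$ (ii) $\Rightarrow$ (iii) $\Rightarrow$ (iv). Moreover, if $X$ is finite dimensional, then (iv) $\Rightarrow$ (ii).
   Context: $X$ is a (real) Banach space with topological dual $X^*$; $\langle x,x^*\rangle:=x^*(x)$. $F(X)$ is the class of functions $J:X\to\mathbb{R}\cup\{+\infty\}$ with $\operatorname{dom}J:=\{x\in X: J(x)<\infty\}\neq\emptyset$. $\Gamma(X)$ is the set of lower semicontinuous proper convex functions on $X$. Subdifferential: $\partial H(x):=\{x^*\in X^*: H(u)\ge H(x)+\langle u-x,x^*\rangle\ \forall u\in X\}$ if $H(x)\in\mathbb{R}$, and $\emptyset$ otherwise; $(\partial H)^{-1}(x^* ):=\{x\in X: x^*\in\partial H(x)\}$. The domain of a set-valued map is the set of points where its value is nonempty. $\Gamma_0$ is the set of lower semicontinuous convex functions $\psi:\mathbb{R}_+\to[0,\infty]$ such that $\psi(t)=0\iff t=0$. For $x\in\operatorname{dom}\partial H$, $x^*\in\partial H(x)$ and $\psi\in\Gamma_0$, consider the inequality $$(\star)\qquad H(u)\ge H(x)+\langle u-x,x^*\rangle+\psi(\|u-x\|)\quad\forall u\in X.$$ Totally convex: a convex $H\in F(X)$ is totally convex at $x\in\operatorname{dom}H$ if, with $H'(x,d)$ denoting the right-hand side derivative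 of $H$ at $x$ in the direction $d$, $\inf\{H(u)-H(x)-H'(x,u-x): u\in\operatorname{dom}H,\ \|u-x\|=t\}>0$ for all $t>0$ (with $\inf\emptyset=+\infty$). Essentially firmly subdifferentiable: $H\in F(X)$ is convex and, for every $x\in\operatorname{dom}\partial H$ and every $x^*\in\partial H(x)$, there exists $\psi\in\Gamma_0$ such that $(\star)$ holds. Essentially strictly convex (in the sense of Bauschke–Borwein–Combettes): $H\in\Gamma(X)$, $(\partial H)^{-1}$ is locally bounded on its domain (every point of $\operatorname{dom}(\partial H)^{-1}$ has a neighbourhood $V$ such that $(\partial H)^{-1}(V)$ is bounded), and $H$ is strictly convex on every convex subset of $\operatorname{dom}\partial H$. Essentially strongly convex: $H\in\Gamma(X)$ is essentially strictly convex and for every $x\in\operatorname{dom}\partial H$ there exist $x^*\in\partial H(x)$ and $\psi\in\Gamma_0$ such that $(\star)$ holds. *)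

theory Defs
  imports "HOL-Analysis.Analysis"
begin

text \<open>
  Functions with values in $\mathbb{R}\cup\{+\infty\}$ are rendered as \<^typ>\<open>ereal\<close>-valued
  functions that avoid \<^term>\<open>-\<infinity>\<close>. The topological dual of \<^typ>\<open>'a\<close> is
  \<^typ>\<open>'a \<Rightarrow>\<^sub>L real\<close> with the operator norm.
\<close>

definition effdom :: "('a \<Rightarrow> ereal) \<Rightarrow> 'a set" where
  "effdom J = {x. J x < \<infinity>}"

definition proper_funs :: "('a \<Rightarrow> ereal) set" where
  "proper_funs = {J. (\<forall>x. J x \<noteq> -\<infinity>) \<and> effdom J \<noteq> {}}"

definition econvex_on :: "'a::real_vector set \<Rightarrow> ('a \<Rightarrow> ereal) \<Rightarrow> bool" where
  "econvex_on S f \<longleftrightarrow> convex S \<and>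
     (\<forall>x\<in>S. \<forall>y\<in>S. \<forall>u>0. \<forall>v>0. u + v = 1 \<longrightarrow>
        f (u *\<^sub>R x + v *\<^sub>R y) \<le> ereal u * f x + ereal v * f y)"

definition strictly_econvex_on :: "'a::real_vector set \<Rightarrow> ('a \<Rightarrow> ereal) \<Rightarrow> bool" where
  "strictly_econvex_on S f \<longleftrightarrow> convex S \<and>
     (\<forall>x\<in>S. \<forall>y\<in>S. \<forall>u>0. \<forall>v>0. x \<noteq> y \<and> u + v = 1 \<longrightarrow>
        f (u *\<^sub>R x + v *\<^sub>R y) < ereal u * f x + ereal v * f y)"

definition lsc_on :: "'a::topological_space set \<Rightarrow> ('a \<Rightarrow> ereal) \<Rightarrow> bool" where
  "lsc_on S f \<longleftrightarrow> (\<forall>x\<in>S. f x \<le> Liminf (at x within S) f)"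

definition Gamma_funs :: "('a::real_normed_vector \<Rightarrow> ereal) set" where
  "Gamma_funs = {H \<in> proper_funs. lsc_on UNIV H \<and> econvex_on UNIV H}"

definition subdiff :: "('a::real_normed_vector \<Rightarrow> ereal) \<Rightarrow> 'a \<Rightarrow> ('a \<Rightarrow>\<^sub>L real) set" where
  "subdiff H x =
     (if \<bar>H x\<bar> \<noteq> \<infinity>
      then {xs. \<forall>u. H u \<ge> H x + ereal (blinfun_apply xs (u - x))}
      else {})"

definition subdiff_inv :: "('a::real_normed_vector \<Rightarrow> ereal) \<Rightarrow> ('a \<Rightarrow>\<^sub>L real) \<Rightarrow> 'a set" where
  "subdiff_inv H xs = {x. xs \<in> subdiff H x}"

definition setmap_dom :: "('a \<Rightarrow> 'b set) \<Rightarrow> 'a set" where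
  "setmap_dom T = {x. T x \<noteq> {}}"

text \<open>
  The elements of $\Gamma_0$ live on $[0,\infty)$; the values of \<open>\<psi>\<close> at negative reals are
  unconstrained and never used.
\<close>

definition Gamma0 :: "(real \<Rightarrow> ereal) set" where
  "Gamma0 = {\<psi>. (\<forall>t\<ge>0. 0 \<le> \<psi> t) \<and> lsc_on {0..} \<psi> \<and> econvex_on {0..} \<psi> \<and>
                  (\<forall>t\<ge>0. \<psi> t = 0 \<longleftrightarrow> t = 0)}"

definition firm_subgradient_ineq ::
  "('a::real_normed_vector \<Rightarrow> ereal) \<Rightarrow> 'a \<Rightarrow> ('a \<Rightarrow>\<^sub>L real) \<Rightarrow> (real \<Rightarrow> ereal) \<Rightarrow> bool" where
  "firm_subgradient_ineq H x xs \<psi> \<longleftrightarrow>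
     (\<forall>u. H u \<ge> H x + ereal (blinfun_apply xs (u - x)) + \<psi> (norm (u - x)))"

text \<open>
  The limit is taken in \<^typ>\<open>ereal\<close>; it exists (possibly infinite) whenever \<open>H\<close> is convex
  and finite at \<open>x\<close>, since the difference quotient is then nondecreasing in \<open>t > 0\<close>.
\<close>

definition right_dirderiv :: "('a::real_normed_vector \<Rightarrow> ereal) \<Rightarrow> 'a \<Rightarrow> 'a \<Rightarrow> ereal" where
  "right_dirderiv H x d = Lim (at_right (0::real)) (\<lambda>t. (H (x + t *\<^sub>R d) - H x) / ereal t)"

text \<open>
  Below, \<open>H u - H x\<close> is finite and the directional derivative is less than \<^term>\<open>\<infinity>::ereal\<close>,
  so the differences are unambiguous; the infimum over the empty set is \<^term>\<open>\<infinity>::ereal\<close>.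
\<close>

definition totally_convex_at :: "('a::real_normed_vector \<Rightarrow> ereal) \<Rightarrow> 'a \<Rightarrow> bool" where
  "totally_convex_at H x \<longleftrightarrow>
     H \<in> proper_funs \<and> econvex_on UNIV H \<and> x \<in> effdom H \<and>
     (\<forall>t>0. (INF u \<in> {u \<in> effdom H. norm (u - x) = t}.
                H u - H x - right_dirderiv H x (u - x)) > 0)"

definition ess_firmly_subdifferentiable :: "('a::real_normed_vector \<Rightarrow> ereal) \<Rightarrow> bool" where
  "ess_firmly_subdifferentiable H \<longleftrightarrow>
     H \<in> proper_funs \<and> econvex_on UNIV H \<and>
     (\<forall>x \<in> setmap_dom (subdiff H). \<forall>xs \<in> subdiff H x.
        \<exists>\<psi> \<in> Gamma0. firm_subgradient_ineq H x xs \<psi>)"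

definition locally_bounded_on_dom ::
  "('a::topological_space \<Rightarrow> 'b::metric_space set) \<Rightarrow> bool" where
  "locally_bounded_on_dom T \<longleftrightarrow>
     (\<forall>p \<in> setmap_dom T. \<exists>V. open V \<and> p \<in> V \<and> bounded (\<Union>v\<in>V. T v))"

definition ess_strictly_convex :: "('a::real_normed_vector \<Rightarrow> ereal) \<Rightarrow> bool" where
  "ess_strictly_convex H \<longleftrightarrow>
     H \<in> Gamma_funs \<and> locally_bounded_on_dom (subdiff_inv H) \<and>
     (\<forall>C. convex C \<and> C \<subseteq> setmap_dom (subdiff H) \<longrightarrow> strictly_econvex_on C H)"

definition ess_strongly_convex :: "('a::real_normed_vector \<Rightarrow> ereal) \<Rightarrow> bool" where
  "ess_strongly_convex H \<longleftrightarrow>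
     H \<in> Gamma_funs \<and> ess_strictly_convex H \<and>
     (\<forall>x \<in> setmap_dom (subdiff H).
        \<exists>xs \<in> subdiff H x. \<exists>\<psi> \<in> Gamma0. firm_subgradient_ineq H x xs \<psi>)"

end

theory Submission
  imports Defs
begin

text \<open>
  Fix a subgradient \<open>xs\<close> of \<open>H\<close> at \<open>x\<close> and consider the gap
  \<open>H u - H x - xs (u - x) \<ge> 0\<close>. Everything reduces to how positive this gap is on the spheres
  around \<open>x\<close>: convexity makes gap divided by distance nondecreasing along rays from \<open>x\<close>,
  so a positive lower bound on every sphere already yields a single modulus in \<open>Gamma0\<close>
  below the gap (\<open>firm_if_gap_positive_on_spheres\<close>). The two implications that end in essential
  firm subdifferentiability provide such bounds.

  Under total convexity the bound is immediate, since every subgradient in direction \<open>d\<close> lies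
  below the directional derivative, so the gap dominates the quantity whose infimum is assumed
  positive. In finite dimension, the points where the gap vanishes form the convex set
  \<open>subdiff_inv H xs\<close>, on which \<open>H\<close> is affine; strict convexity shrinks it to \<open>{x}\<close>, and compactness
  of spheres together with lower semicontinuity turns pointwise positivity into a uniform bound.

  Conversely, let \<open>H\<close> be essentially firmly subdifferentiable. Applying the firm inequality at an
  interior point of a segment to both endpoints and averaging cancels the linear terms and leaves
  strict convexity. A modulus grows at least linearly, say with slope \<open>a\<close>, so changing \<open>xs\<close> by less than
  \<open>a\<close> cannot move a minimiser of \<open>H - xs\<close> further than distance 1 from \<open>x\<close>; this is local boundedness
  of the inverse subdifferential.
\<close>

section \<open>Moduli in \<open>Gamma0\<close>\<close>

lemma econvex_onD:
  assumes "econvex_on S f" "x \<in> S" "y \<in> S" "0 < u" "0 < v" "u + v = 1"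
  shows "f (u *\<^sub>R x + v *\<^sub>R y) \<le> ereal u * f x + ereal v * f y"
  using assms unfolding econvex_on_def by blast

text \<open>
  Suppose that \<open>\<phi> \<ge> 0\<close> satisfies \<open>\<phi> t \<ge> c s * (t / s)\<close> for \<open>s \<le> t\<close>, as a gap function with bound
  \<open>c s\<close> at distance \<open>s\<close> does. The line through \<open>(s, 0)\<close> with slope \<open>c s / s\<close> is then below \<open>\<phi>\<close>: up to
  \<open>s\<close> it is nonpositive, and beyond \<open>s\<close> it is below \<open>c s * (t / s)\<close>. The supremum of the positive parts of
  these lines is convex and lower semicontinuous, vanishes at 0, and is positive elsewhere. The value
  \<open>y\<close> plays the role of \<open>\<phi> t\<close>.
\<close>

lemma Gamma0_minorant:
  fixes c :: "real \<Rightarrow> real"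
  assumes c: "\<And>s. 0 < s \<Longrightarrow> 0 < c s"
  shows "\<exists>\<psi>\<in>Gamma0. \<forall>t\<ge>0. \<forall>y\<ge>0. (\<forall>s. 0 < s \<and> s \<le> t \<longrightarrow> ereal (c s * (t / s)) \<le> y) \<longrightarrow> \<psi> t \<le> y"
proof -
  define g where "g = (\<lambda>s t. max 0 (c s / s * (t - s)))"
  define \<psi> where "\<psi> = (\<lambda>t. SUP s\<in>{0<..}. ereal (g s t))"
  have g_le: "ereal (g s t) \<le> \<psi> t" if "0 < s" for s t
    unfolding \<psi>_def using that by (intro SUP_upper) auto
  have minorant: "\<psi> t \<le> y"
    if t: "0 \<le> t" and y: "0 \<le> y" and *: "\<And>s. \<lbrakk>0 < s; s \<le> t\<rbrakk> \<Longrightarrow> ereal (c s * (t / s)) \<le> y" for t y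
    unfolding \<psi>_def
  proof (rule SUP_least)
    fix s :: real assume "s \<in> {0<..}"
    then have s: "0 < s" by simp
    show "ereal (g s t) \<le> y"
    proof (cases "s \<le> t")
      case True
      have "g s t \<le> c s * (t / s)"
        using s c[OF s] t by (auto simp: g_def field_simps)
      then show ?thesis using *[OF s True] by (metis ereal_less_eq(3) order_trans)
    next
      case False
      then have "g s t = 0"
        using s c[OF s] by (auto simp: g_def max_def mult_le_0_iff zero_le_mult_iff divide_le_0_iff zero_le_divide_iff)
      then show ?thesis using y by (simp add: zero_ereal_def)
    qed
  qed
  have nonneg: "0 \<le> \<psi> t" for t
  proof -
    have "0 \<le> g 1 t" by (simp add: g_def)
    then have "0 \<le> ereal (g 1 t)" by simp
    also have "\<dots> \<le> \<psi> t" by (rule g_le) simp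
    finally show ?thesis .
  qed
  have zero: "\<psi> 0 = 0"
    using minorant[of 0 0] nonneg[of 0] by (simp add: antisym)
  have pos: "\<psi> t \<noteq> 0" if "0 < t" for t
  proof -
    \<comment> \<open>any line based at a point of \<open>(0, t)\<close> is positive at \<open>t\<close>; take the midpoint\<close>
    have "0 < c (t/2) / (t/2) * (t - t/2)"
      using that c[of "t/2"] by (intro mult_pos_pos divide_pos_pos) auto
    then have "0 < ereal (g (t/2) t)" unfolding g_def by simp
    also have "\<dots> \<le> \<psi> t" using that by (intro g_le) simp
    finally show ?thesis by simp
  qed
  have lsc: "lsc_on {0..} \<psi>"
    unfolding lsc_on_def
  proof
    fix x :: real
    show "\<psi> x \<le> Liminf (at x within {0..}) \<psi>"
      unfolding le_Liminf_iff
    proof (intro allI impI)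
      fix y assume "y < \<psi> x"
      then obtain s where s: "0 < s" "y < ereal (g s x)"
        unfolding \<psi>_def less_SUP_iff by auto
      have "((\<lambda>t. ereal (g s t)) \<longlongrightarrow> ereal (g s x)) (at x within {0..})"
        unfolding g_def by (intro tendsto_intros)
      from order_tendstoD(1)[OF this s(2)]
      show "\<forall>\<^sub>F t in at x within {0..}. y < \<psi> t"
        by eventually_elim (use g_le[OF s(1)] in \<open>auto intro: less_le_trans\<close>)
    qed
  qed
  have conv: "econvex_on {0..} \<psi>"
    unfolding econvex_on_def
  proof (intro conjI ballI allI impI)
    fix x y u v :: real assume uv: "0 < u" "0 < v" "u + v = 1"
    show "\<psi> (u *\<^sub>R x + v *\<^sub>R y) \<le> ereal u * \<psi> x + ereal v * \<psi> y"
      unfolding \<psi>_def[THEN fun_cong, of "u *\<^sub>R x + v *\<^sub>R y"]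
    proof (rule SUP_least)
      fix s :: real assume "s \<in> {0<..}"
      then have s: "0 < s" by simp
      define k where "k = c s / s"
      have "k * (u * x + v * y - s) = u * (k * (x - s)) + v * (k * (y - s))"
      proof -
        have "s = u * s + v * s" using uv by (metis distrib_right mult_1)
        then show ?thesis by (simp add: algebra_simps) (metis distrib_left mult.left_commute)
      qed
      also have "\<dots> \<le> u * g s x + v * g s y"
        unfolding g_def k_def[symmetric] using uv by (intro add_mono mult_left_mono) auto
      finally have "k * (u * x + v * y - s) \<le> u * g s x + v * g s y" .
      moreover have "0 \<le> u * g s x + v * g s y" using uv by (simp add: g_def)
      ultimately have "ereal (g s (u *\<^sub>R x + v *\<^sub>R y)) \<le> ereal u * ereal (g s x) + ereal v * ereal (g s y)"
        unfolding g_def k_def[symmetric] by (simp del: ereal_max)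
      also have "\<dots> \<le> ereal u * \<psi> x + ereal v * \<psi> y"
        using uv g_le[OF s] by (intro add_mono ereal_mult_left_mono) auto
      finally show "ereal (g s (u *\<^sub>R x + v *\<^sub>R y)) \<le> \<dots>" .
    qed
  qed simp
  have zero_iff: "\<psi> t = 0 \<longleftrightarrow> t = 0" if "0 \<le> t" for t
    using zero pos[of t] that by (cases "t = 0") simp_all
  have "\<psi> \<in> Gamma0"
    using nonneg lsc conv zero_iff by (simp add: Gamma0_def)
  then show ?thesis using minorant by (intro bexI[of _ \<psi>]) simp_all
qed

lemma Gamma0_pos:
  assumes "\<psi> \<in> Gamma0" "0 < t"
  shows "0 < \<psi> t"
proof -
  have "0 \<le> \<psi> t" "\<psi> t \<noteq> 0" using assms unfolding Gamma0_def by auto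
  then show ?thesis by (metis order_le_neq_trans)
qed

text \<open>
  Beyond 1, a convex function that vanishes at 0 stays above the line through the origin and
  \<open>(1, \<psi> 1)\<close>.
\<close>

lemma Gamma0_linear_growth:
  assumes \<psi>: "\<psi> \<in> Gamma0"
  shows "\<exists>a>0. \<forall>t\<ge>1. ereal (a * t) \<le> \<psi> t"
proof -
  have "\<psi> 0 = 0" and nonneg: "\<And>t. 0 \<le> t \<Longrightarrow> 0 \<le> \<psi> t"
    using \<psi> unfolding Gamma0_def by auto
  \<comment> \<open>\<open>\<psi> 1\<close> may be infinite, so the slope is taken strictly below it\<close>
  obtain a where a: "0 < ereal a" "ereal a < \<psi> 1"
    using ereal_dense2[OF Gamma0_pos[OF \<psi> zero_less_one]] by blast
  have "ereal (a * t) \<le> \<psi> t" if t: "1 \<le> t" for t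
  proof (cases "t = 1")
    case True then show ?thesis using a by simp
  next
    case False
    then have t: "1 < t" using t by simp
    have "\<psi> ((1/t) *\<^sub>R t + (1 - 1/t) *\<^sub>R 0) \<le> ereal (1/t) * \<psi> t + ereal (1 - 1/t) * \<psi> 0"
      by (rule econvex_onD[of "{0..}"]) (use \<psi> t in \<open>auto simp: Gamma0_def\<close>)
    then have "ereal a \<le> ereal (1/t) * \<psi> t" using a t \<open>\<psi> 0 = 0\<close> by simp
    then show ?thesis using t nonneg[of t] by (cases "\<psi> t") (auto simp: field_simps)
  qed
  then show ?thesis using a(1) by (intro exI[of _ a]) simp
qed

section \<open>Subgradients of convex functions\<close>

lemma subdiff_iff:
  "xs \<in> subdiff H x \<longleftrightarrow> (\<exists>h. H x = ereal h \<and> (\<forall>u. ereal (h + xs (u - x)) \<le> H u))"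
  unfolding subdiff_def by (cases "H x") auto

lemma econvex_segment:
  assumes "econvex_on UNIV H" "H x = ereal h" "H u = ereal k" "0 < l" "l \<le> 1"
  shows "H (x + l *\<^sub>R (u - x)) \<le> ereal ((1 - l) * h + l * k)"
proof (cases "l = 1")
  case False
  have eq: "x + l *\<^sub>R (u - x) = (1 - l) *\<^sub>R x + l *\<^sub>R u" by (simp add: algebra_simps)
  have "H ((1 - l) *\<^sub>R x + l *\<^sub>R u) \<le> ereal (1 - l) * H x + ereal l * H u"
    by (rule econvex_onD[OF assms(1)]) (use assms False in auto)
  then show ?thesis unfolding eq using assms by simp
qed (use assms in simp)

text \<open>
  The bounds \<open>c\<close> are unrelated for different radii; comparing \<open>u\<close> with the point of the segment from
  \<open>x\<close> to \<open>u\<close> at distance \<open>s\<close> makes them compatible with the minorant construction.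
\<close>

lemma firm_if_gap_positive_on_spheres:
  assumes conv: "econvex_on UNIV H" and xs: "xs \<in> subdiff H x"
    and gap: "\<And>s. 0 < s \<Longrightarrow> \<exists>c>0. \<forall>u. norm (u - x) = s \<longrightarrow> H x + ereal (xs (u - x)) + ereal c \<le> H u"
  shows "\<exists>\<psi>\<in>Gamma0. firm_subgradient_ineq H x xs \<psi>"
proof -
  obtain h where h: "H x = ereal h" and sub: "\<And>u. ereal (h + xs (u - x)) \<le> H u"
    using xs by (auto simp: subdiff_iff)
  have "\<forall>s\<in>{0<..}. \<exists>c>0. \<forall>u. norm (u - x) = s \<longrightarrow> ereal (h + xs (u - x) + c) \<le> H u"
    using gap unfolding h by simp
  from bchoice[OF this] obtain c where c: "\<And>s. 0 < s \<Longrightarrow> 0 < c s"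
    and c_le: "\<And>s u. \<lbrakk>0 < s; norm (u - x) = s\<rbrakk> \<Longrightarrow> ereal (h + xs (u - x) + c s) \<le> H u"
    by auto
  obtain \<psi> where \<psi>: "\<psi> \<in> Gamma0" and minorant:
    "\<And>t y. \<lbrakk>0 \<le> t; 0 \<le> y; \<And>s. \<lbrakk>0 < s; s \<le> t\<rbrakk> \<Longrightarrow> ereal (c s * (t / s)) \<le> y\<rbrakk> \<Longrightarrow> \<psi> t \<le> y"
    using Gamma0_minorant[of c, OF c] by auto
  have "H x + ereal (xs (u - x)) + \<psi> (norm (u - x)) \<le> H u" for u
  proof (cases "H u")
    case (real k)
    define t where "t = norm (u - x)"
    have "\<psi> t \<le> ereal (k - h - xs (u - x))"
    proof (rule minorant)
      show "0 \<le> t" by (simp add: t_def)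
      show "0 \<le> ereal (k - h - xs (u - x))" using sub[of u] real by simp
      fix s assume s: "0 < s" "s \<le> t"
      define l where "l = s / t"
      have l: "0 < l" "l \<le> 1" using s by (auto simp: l_def)
      have "norm (x + l *\<^sub>R (u - x) - x) = s"
        using s l by (simp add: t_def[symmetric]) (simp add: l_def)
      from c_le[OF s(1) this]
      have "ereal (h + l * xs (u - x) + c s) \<le> H (x + l *\<^sub>R (u - x))"
        by (simp add: blinfun.scaleR_right)
      also have "\<dots> \<le> ereal ((1 - l) * h + l * k)"
        by (rule econvex_segment[OF conv h real l])
      finally have "c s \<le> l * (k - h - xs (u - x))" by (simp add: algebra_simps)
      then have "c s * (t / s) \<le> k - h - xs (u - x)"
        using s by (simp add: l_def field_simps)
      then show "ereal (c s * (t / s)) \<le> ereal (k - h - xs (u - x))" by simp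
    qed
    then show ?thesis using h real unfolding t_def by (cases "\<psi> (norm (u - x))") simp_all
  qed (use sub[of u] in simp_all)
  then show ?thesis using \<psi> unfolding firm_subgradient_ineq_def by blast
qed

section \<open>Total convexity\<close>

lemma tendsto_at_right_mono_ereal:
  fixes f :: "real \<Rightarrow> ereal"
  assumes mono: "\<And>s t. \<lbrakk>a < s; s \<le> t\<rbrakk> \<Longrightarrow> f s \<le> f t"
  shows "(f \<longlongrightarrow> (INF t\<in>{a<..}. f t)) (at_right a)"
proof (rule order_tendstoI)
  fix y assume y: "y < (INF t\<in>{a<..}. f t)"
  have "y < f t" if "a < t" for t
    using y INF_lower[of t "{a<..}" f] that by (auto intro: less_le_trans)
  then show "\<forall>\<^sub>F t in at_right a. y < f t"
    by (rule eventually_mono[OF eventually_at_right_less])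
next
  fix y assume "(INF t\<in>{a<..}. f t) < y"
  then obtain t where t: "a < t" "f t < y" by (auto simp: INF_less_iff)
  have "\<forall>\<^sub>F s in at_right a. s \<in> {a<..<t}"
    using t(1) by (rule eventually_at_right_real)
  then show "\<forall>\<^sub>F s in at_right a. f s < y"
    by eventually_elim (use mono t in \<open>auto intro: le_less_trans[of _ "f t"]\<close>)
qed

text \<open>
  Every difference quotient dominates \<open>xs d\<close>; convexity makes the quotient monotone, so its limit
  exists and is its infimum.
\<close>

lemma subgradient_le_right_dirderiv:
  assumes conv: "econvex_on UNIV H" and xs: "xs \<in> subdiff H x"
  shows "ereal (xs d) \<le> right_dirderiv H x d"
proof -
  obtain h where h: "H x = ereal h" and sub: "\<And>u. ereal (h + xs (u - x)) \<le> H u"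
    using xs by (auto simp: subdiff_iff)
  define q where "q = (\<lambda>t. (H (x + t *\<^sub>R d) - H x) / ereal t)"
  have q_real: "q t = ereal ((k - h) / t)" if "0 < t" "H (x + t *\<^sub>R d) = ereal k" for t k
    using that h by (simp add: q_def)
  have q_top: "q t = \<infinity>" if "0 < t" "H (x + t *\<^sub>R d) = \<infinity>" for t
    using that h by (simp add: q_def)
  have mono: "q s \<le> q t" if s: "0 < s" and st: "s \<le> t" for s t
  proof (cases "H (x + t *\<^sub>R d)")
    case (real k)
    have "H (x + (s/t) *\<^sub>R (x + t *\<^sub>R d - x)) \<le> ereal ((1 - s/t) * h + s/t * k)"
      by (rule econvex_segment[OF conv h real]) (use s st in auto)
    then have *: "H (x + s *\<^sub>R d) \<le> ereal ((1 - s/t) * h + s/t * k)" using s st by simp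
    then obtain m where m: "H (x + s *\<^sub>R d) = ereal m"
      using sub[of "x + s *\<^sub>R d"] by (cases "H (x + s *\<^sub>R d)") auto
    have "m - h \<le> s * ((k - h) / t)" using * m s st by (simp add: field_simps)
    then have "(m - h) / s \<le> (k - h) / t" using s by (simp add: divide_le_eq mult.commute)
    moreover have "0 < t" using s st by simp
    ultimately show ?thesis using q_real[OF s m] q_real[OF _ real] by simp
  next
    case PInf
    then show ?thesis using q_top[of t] s st by simp
  next
    case MInf
    then show ?thesis using sub[of "x + t *\<^sub>R d"] by simp
  qed
  have "(q \<longlongrightarrow> (INF t\<in>{0<..}. q t)) (at_right 0)"
    by (rule tendsto_at_right_mono_ereal) (rule mono)
  then have "right_dirderiv H x d = (INF t\<in>{0<..}. q t)"
    unfolding right_dirderiv_def q_def by (intro tendsto_Lim) auto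
  moreover have "ereal (xs d) \<le> q t" if t: "0 < t" for t
  proof (cases "H (x + t *\<^sub>R d)")
    case (real k)
    then have "h + t * xs d \<le> k" using sub[of "x + t *\<^sub>R d"] by (simp add: blinfun.scaleR_right)
    then have "xs d \<le> (k - h) / t" using t by (simp add: pos_le_divide_eq mult.commute)
    then show ?thesis using q_real[OF t real] by simp
  next
    case PInf
    then show ?thesis using q_top[OF t] by simp
  next
    case MInf
    then show ?thesis using sub[of "x + t *\<^sub>R d"] by simp
  qed
  ultimately show ?thesis by (simp add: le_INF_iff)
qed

text \<open>
  Replacing the directional derivative by the smaller value of the subgradient only enlarges the gap.
\<close>

lemma totally_convex_imp_firm:
  assumes tc: "totally_convex_at H x" and xs: "xs \<in> subdiff H x"
  shows "\<exists>\<psi>\<in>Gamma0. firm_subgradient_ineq H x xs \<psi>"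
proof (rule firm_if_gap_positive_on_spheres[OF _ xs])
  show conv: "econvex_on UNIV H" using tc by (simp add: totally_convex_at_def)
  obtain h where h: "H x = ereal h" and sub: "\<And>u. ereal (h + xs (u - x)) \<le> H u"
    using xs by (auto simp: subdiff_iff)
  fix s :: real assume s: "0 < s"
  define I where "I = (INF u \<in> {u \<in> effdom H. norm (u - x) = s}. H u - H x - right_dirderiv H x (u - x))"
  have "0 < I" using tc s unfolding totally_convex_at_def I_def by simp
  then obtain c where c: "0 < ereal c" "ereal c < I" using ereal_dense2 by blast
  have "H x + ereal (xs (u - x)) + ereal c \<le> H u" if u: "norm (u - x) = s" for u
  proof (cases "H u")
    case (real k)
    then have "I \<le> H u - H x - right_dirderiv H x (u - x)"
      unfolding I_def using u by (intro INF_lower) (auto simp: effdom_def)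
    also have "\<dots> \<le> H u - H x - ereal (xs (u - x))"
      by (intro ereal_minus_mono order_refl subgradient_le_right_dirderiv[OF conv xs])
    finally have "ereal c \<le> \<dots>" using c by simp
    then show ?thesis using real h by simp
  qed (use sub[of u] in auto)
  then show "\<exists>c>0. \<forall>u. norm (u - x) = s \<longrightarrow> H x + ereal (xs (u - x)) + ereal c \<le> H u"
    using c(1) by (intro exI[of _ c]) simp
qed

section \<open>Consequences of firm subdifferentiability\<close>

text \<open>
  The subgradient inequality at \<open>z = u *\<^sub>R x + v *\<^sub>R y\<close> is strict at \<open>x\<close> and \<open>y\<close>; in the weighted
  average the linear terms cancel because \<open>z\<close> is the barycentre.
\<close>

lemma firm_imp_strictly_convex:
  assumes firm: "\<And>z. z \<in> C \<Longrightarrow> \<exists>zs \<in> subdiff H z. \<exists>\<psi>\<in>Gamma0. firm_subgradient_ineq H z zs \<psi>"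
    and C: "convex C"
  shows "strictly_econvex_on C H"
  unfolding strictly_econvex_on_def
proof (intro conjI C ballI allI impI, elim conjE)
  fix x y u v assume xy: "x \<in> C" "y \<in> C" "x \<noteq> y" and uv: "0 < u" "0 < v" "u + v = (1::real)"
  define z where "z = u *\<^sub>R x + v *\<^sub>R y"
  have "z \<in> C" using C xy uv unfolding z_def convex_def by auto
  then obtain zs \<psi> where zs: "zs \<in> subdiff H z" and \<psi>: "\<psi> \<in> Gamma0"
    and ineq: "\<And>w. H z + ereal (zs (w - z)) + \<psi> (norm (w - z)) \<le> H w"
    using firm[OF \<open>z \<in> C\<close>] unfolding firm_subgradient_ineq_def by blast
  obtain h where h: "H z = ereal h" using zs by (auto simp: subdiff_iff)
  have finite: "\<exists>k. H w = ereal k" if "w \<in> C" for w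
    using firm[OF that] by (auto simp: subdiff_iff)
  obtain k where k: "H x = ereal k" using finite xy by blast
  obtain m where m: "H y = ereal m" using finite xy by blast
  have vu: "v = 1 - u" using uv by simp
  have xz: "x - z = v *\<^sub>R (x - y)" and yz: "y - z = u *\<^sub>R (y - x)"
    unfolding z_def vu by (simp_all add: algebra_simps)
  have strict: "h + zs (w - z) < k'" if "w \<noteq> z" "H w = ereal k'" for w k'
  proof -
    have "0 < \<psi> (norm (w - z))" using Gamma0_pos[OF \<psi>] that by simp
    then show ?thesis using ineq[of w] h that by (cases "\<psi> (norm (w - z))") auto
  qed
  have "x - z \<noteq> 0" "y - z \<noteq> 0" unfolding xz yz using xy uv by simp_all
  then have "x \<noteq> z" "y \<noteq> z" by simp_all
  then have "u * (h + zs (x - z)) + v * (h + zs (y - z)) < u * k + v * m"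
    using strict k m uv by (intro add_strict_mono mult_strict_left_mono) auto
  moreover have "u * (h + zs (x - z)) + v * (h + zs (y - z)) = h"
  proof -
    have "u * zs (x - z) + v * zs (y - z) = 0"
      unfolding xz yz by (simp add: blinfun.scaleR_right blinfun.diff_right algebra_simps)
    then show ?thesis using uv by (simp add: vu algebra_simps)
  qed
  ultimately show "H (u *\<^sub>R x + v *\<^sub>R y) < ereal u * H x + ereal v * H y"
    using h k m by (simp add: z_def)
qed

text \<open>
  If \<open>ys\<close> is a subgradient at \<open>u\<close> with \<open>norm (u - x) > 1\<close>, adding its inequality at \<open>x\<close> to the firm
  inequality for \<open>u\<close> gives \<open>a * norm (u - x) \<le> (ys - xs) (u - x)\<close>, hence \<open>a \<le> norm (ys - xs)\<close>.
  The inverse subdifferential therefore maps the ball of radius \<open>a\<close> around \<open>xs\<close> into \<open>cball x 1\<close>.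
\<close>

lemma firm_imp_subdiff_inv_locally_bounded:
  assumes firm: "\<And>x xs. xs \<in> subdiff H x \<Longrightarrow> \<exists>\<psi>\<in>Gamma0. firm_subgradient_ineq H x xs \<psi>"
  shows "locally_bounded_on_dom (subdiff_inv H)"
  unfolding locally_bounded_on_dom_def
proof
  fix xs assume "xs \<in> setmap_dom (subdiff_inv H)"
  then obtain x where xs: "xs \<in> subdiff H x" by (auto simp: setmap_dom_def subdiff_inv_def)
  obtain h where h: "H x = ereal h" using xs by (auto simp: subdiff_iff)
  obtain \<psi> where \<psi>: "\<psi> \<in> Gamma0"
    and ineq: "\<And>u. H x + ereal (xs (u - x)) + \<psi> (norm (u - x)) \<le> H u"
    using firm[OF xs] unfolding firm_subgradient_ineq_def by blast
  obtain a :: real where a: "0 < a" "\<And>t. 1 \<le> t \<Longrightarrow> ereal (a * t) \<le> \<psi> t"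
    using Gamma0_linear_growth[OF \<psi>] by auto
  have "norm (u - x) \<le> 1" if ys: "ys \<in> ball xs a" and u: "ys \<in> subdiff H u" for ys u
  proof (rule ccontr)
    assume "\<not> norm (u - x) \<le> 1"
    then have n: "1 < norm (u - x)" by simp
    obtain k where k: "H u = ereal k" and sub: "k + ys (x - u) \<le> h"
      using u h by (auto simp: subdiff_iff) (metis ereal_less_eq(3))
    have "h + xs (u - x) + a * norm (u - x) \<le> k"
      using ineq[of u] a(2)[of "norm (u - x)"] n h k by (cases "\<psi> (norm (u - x))") auto
    with sub have "a * norm (u - x) \<le> (ys - xs) (u - x)"
      by (simp add: blinfun.diff_left blinfun.diff_right)
    also have "\<dots> \<le> norm (ys - xs) * norm (u - x)"
      using norm_blinfun[of "ys - xs" "u - x"] by simp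
    finally have "a \<le> norm (ys - xs)"
      by (rule mult_right_le_imp_le) (use n in linarith)
    then show False using ys by (simp add: dist_norm norm_minus_commute)
  qed
  then have "(\<Union>ys\<in>ball xs a. subdiff_inv H ys) \<subseteq> cball x 1"
    by (auto simp: subdiff_inv_def dist_norm norm_minus_commute)
  then have "bounded (\<Union>ys\<in>ball xs a. subdiff_inv H ys)"
    by (rule bounded_subset[OF bounded_cball])
  then show "\<exists>V. open V \<and> xs \<in> V \<and> bounded (\<Union>v\<in>V. subdiff_inv H v)"
    using a(1) by (intro exI[of _ "ball xs a"]) auto
qed

section \<open>The finite-dimensional case\<close>

text \<open>
  The classical fact that bounded closed subsets of a finite-dimensional normed space are compact,
  by adding one spanning vector \<open>b\<close> at a time: by induction the old span is closed, so \<open>b\<close> has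
  positive distance \<open>d\<close> from it. Hence the coefficient of \<open>b\<close> in a vector \<open>z\<close> is at most \<open>norm z / d\<close>,
  and the ball in the new span is contained in the image of a compact product.
\<close>

lemma compact_cball_Int_span:
  fixes B :: "'a::real_normed_vector set"
  assumes "finite B"
  shows "compact (cball 0 R \<inter> span B)"
  using assms
proof (induction B arbitrary: R rule: finite_induct)
  case empty
  show ?case by (simp add: finite_imp_compact)
next
  case (insert b B)
  show ?case
  proof (cases "b \<in> span B")
    case True
    then show ?thesis using insert.IH by (simp add: span_redundant)
  next
    case False
    have "closed (cball 0 (norm b + 1) \<inter> span B)" using insert.IH by (rule compact_imp_closed)
    then obtain e where e: "0 < e" "ball b e \<inter> (cball 0 (norm b + 1) \<inter> span B) = {}"
      using False by (metis Int_iff open_Compl Compl_iff open_contains_ball disjoint_eq_subset_Compl inf_commute)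
    \<comment> \<open>the cap at 1 keeps points near \<open>b\<close> inside the ball of radius \<open>norm b + 1\<close> used for closedness\<close>
    define d where "d = min e 1"
    have d: "0 < d" using e by (simp add: d_def)
    have far: "d \<le> norm (b - w)" if "w \<in> span B" for w
    proof (rule ccontr)
      assume "\<not> d \<le> norm (b - w)"
      then have "norm (b - w) < e" "norm (b - w) < 1" by (auto simp: d_def)
      moreover have "norm w \<le> norm b + norm (b - w)"
        by (metis norm_minus_commute norm_triangle_sub)
      ultimately show False using e(2) that by (auto simp: dist_norm)
    qed
    define T where "T = R / d"
    define K where "K = (\<lambda>(t, w). t *\<^sub>R b + w) ` (cball 0 T \<times> (cball 0 (R + T * norm b) \<inter> span B))"
    have "compact K"
      unfolding K_def split_def
      by (intro compact_continuous_image compact_Times insert.IH compact_cball continuous_intros)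
    moreover have "cball 0 R \<inter> span (insert b B) = cball 0 R \<inter> K"
    proof (intro equalityI subsetI)
      fix z assume z: "z \<in> cball 0 R \<inter> span (insert b B)"
      then obtain t where t: "z - t *\<^sub>R b \<in> span B" by (auto simp: span_insert)
      have "norm t * d \<le> norm z"
      proof (cases "t = 0")
        case False
        have "d \<le> norm (b - (- (1/t)) *\<^sub>R (z - t *\<^sub>R b))" using t by (intro far span_mul)
        also have "b - (- (1/t)) *\<^sub>R (z - t *\<^sub>R b) = (1/t) *\<^sub>R z" using False by (simp add: algebra_simps)
        finally show ?thesis using False by (simp add: field_simps)
      qed simp
      then have "norm t \<le> T" using z d by (simp add: T_def field_simps)
      moreover have "norm (z - t *\<^sub>R b) \<le> R + T * norm b"
      proof -
        have "norm (z - t *\<^sub>R b) \<le> norm z + norm t * norm b"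
          using norm_triangle_ineq4[of z "t *\<^sub>R b"] by simp
        also have "\<dots> \<le> R + T * norm b"
          using z \<open>norm t \<le> T\<close> by (intro add_mono mult_right_mono) auto
        finally show ?thesis .
      qed
      ultimately have "(t, z - t *\<^sub>R b) \<in> cball 0 T \<times> (cball 0 (R + T * norm b) \<inter> span B)" using t by simp
      then have "z \<in> K" unfolding K_def by (rule rev_image_eqI) simp
      with z show "z \<in> cball 0 R \<inter> K" by simp
    next
      fix z assume "z \<in> cball 0 R \<inter> K"
      then show "z \<in> cball 0 R \<inter> span (insert b B)"
        using span_mono[of B "insert b B"]
        by (auto simp: K_def intro: span_add[OF span_scale[OF span_base]])
    qed
    ultimately show ?thesis by (simp add: closed_Int_compact)
  qed
qed

lemma compact_sphere_finite_dim:
  fixes B :: "'a::real_normed_vector set"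
  assumes "finite B" "span B = UNIV"
  shows "compact (sphere (x::'a) r)"
proof -
  have "compact (cball (0::'a) (norm x + r))"
    using compact_cball_Int_span[OF assms(1)] assms(2) by simp
  moreover have "sphere x r \<subseteq> cball 0 (norm x + r)"
    using norm_triangle_sub by (fastforce simp: dist_norm norm_minus_commute)
  moreover have "closed (sphere x r)"
    unfolding sphere_def by (intro closed_Collect_eq continuous_intros)
  ultimately show ?thesis by (metis closed_Int_compact inf.absorb1)
qed

lemma open_continuous_less_lsc:
  fixes g :: "'a::topological_space \<Rightarrow> real"
  assumes lsc: "lsc_on UNIV H" and g: "continuous_on UNIV g"
  shows "open {u. ereal (g u) < H u}"
proof (subst open_subopen, safe)
  fix u assume "ereal (g u) < H u"
  then obtain r where r: "ereal (g u) < ereal r" "ereal r < H u" using ereal_dense2 by blast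
  have "H u \<le> Liminf (at u) H" using lsc by (simp add: lsc_on_def)
  with r(2) have "\<forall>\<^sub>F w in at u. ereal r < H w" by (simp add: le_Liminf_iff)
  then have "\<forall>\<^sub>F w in nhds u. ereal r < H w"
    unfolding eventually_at_filter by (rule eventually_mono) (use r(2) in auto)
  then obtain S where S: "open S" "u \<in> S" "\<And>w. w \<in> S \<Longrightarrow> ereal r < H w"
    by (auto simp: eventually_nhds)
  have "open (S \<inter> {w. g w < r})"
    using S(1) g by (intro open_Int open_Collect_less continuous_intros)
  moreover have "S \<inter> {w. g w < r} \<subseteq> {u. ereal (g u) < H u}"
  proof safe
    fix w assume "w \<in> S" "g w < r"
    then have "ereal (g w) < ereal r" by simp
    also have "\<dots> < H w" using S(3) \<open>w \<in> S\<close> .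
    finally show "ereal (g w) < H w" .
  qed
  ultimately show "\<exists>V. open V \<and> u \<in> V \<and> V \<subseteq> {u. ereal (g u) < H u}"
    using S(2) r(1) by (intro exI[of _ "S \<inter> {w. g w < r}"]) simp
qed

text \<open>
  By lower semicontinuity the sets where \<open>H\<close> exceeds \<open>g + c\<close> are open. They cover \<open>K\<close>, so finitely
  many suffice, and the smallest of the corresponding constants works.
\<close>

lemma strict_minorant_gap_on_compact:
  fixes g :: "'a::topological_space \<Rightarrow> real"
  assumes lsc: "lsc_on UNIV H" and g: "continuous_on UNIV g" and K: "compact K"
    and less: "\<And>u. u \<in> K \<Longrightarrow> ereal (g u) < H u"
  shows "\<exists>c>0. \<forall>u\<in>K. ereal (g u + c) \<le> H u"
proof -
  define U where "U = (\<lambda>c. {u. ereal (g u + c) < H u})"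
  have "\<exists>c>0. u \<in> U c" if u: "u \<in> K" for u
  proof -
    obtain r where "ereal (g u) < ereal r" "ereal r < H u" using ereal_dense2[OF less[OF u]] by blast
    then show ?thesis by (intro exI[of _ "r - g u"]) (simp add: U_def)
  qed
  then have "K \<subseteq> (\<Union>c\<in>{0<..}. U c)" by auto
  moreover have "open (U c)" for c
    unfolding U_def by (intro open_continuous_less_lsc lsc continuous_intros g)
  ultimately obtain C where C: "C \<subseteq> {0<..}" "finite C" "K \<subseteq> (\<Union>c\<in>C. U c)"
    using compactE_image[OF K, of "{0<..}" U] by metis
  \<comment> \<open>the inserted 1 covers the case \<open>C = {}\<close>\<close>
  define m where "m = Min (insert 1 C)"
  have "0 < m" using C by (auto simp: m_def)
  moreover have "ereal (g u + m) \<le> H u" if u: "u \<in> K" for u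
  proof -
    obtain c where c: "c \<in> C" "ereal (g u + c) < H u" using u C(3) by (auto simp: U_def)
    have "ereal (g u + m) \<le> ereal (g u + c)" using c C(2) by (simp add: m_def)
    also have "\<dots> < H u" by (rule c(2))
    finally show ?thesis by simp
  qed
  ultimately show ?thesis by blast
qed

text \<open>
  The points of \<open>subdiff_inv H xs\<close> are the minimisers of the convex function \<open>H - xs\<close>, and these form
  a sublevel set.
\<close>

lemma convex_subdiff_inv:
  assumes conv: "econvex_on UNIV H"
  shows "convex (subdiff_inv H xs)"
  unfolding convex_alt
proof (intro ballI allI impI)
  fix x y and l :: real
  assume x: "x \<in> subdiff_inv H xs" and y: "y \<in> subdiff_inv H xs" and l: "0 \<le> l \<and> l \<le> 1"
  obtain h where h: "H x = ereal h" "\<And>u. ereal (h + xs (u - x)) \<le> H u"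
    using x by (auto simp: subdiff_inv_def subdiff_iff)
  obtain k where k: "H y = ereal k" "\<And>u. ereal (k + xs (u - y)) \<le> H u"
    using y by (auto simp: subdiff_inv_def subdiff_iff)
  show "(1 - l) *\<^sub>R x + l *\<^sub>R y \<in> subdiff_inv H xs"
  proof (cases "l = 0")
    case False
    then have "H (x + l *\<^sub>R (y - x)) \<le> ereal ((1 - l) * h + l * k)"
      using econvex_segment[OF conv h(1) k(1)] l by simp
    moreover have k_eq: "k = h + xs (y - x)"
      using h(2)[of y] k(2)[of x] h(1) k(1) by (simp add: blinfun.diff_right)
    ultimately have "H (x + l *\<^sub>R (y - x)) \<le> ereal (h + l * xs (y - x))"
      by (simp add: algebra_simps)
    with h(2)[of "x + l *\<^sub>R (y - x)"] have "H (x + l *\<^sub>R (y - x)) = ereal (h + l * xs (y - x))"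
      by (simp add: blinfun.scaleR_right)
    then have "xs \<in> subdiff H (x + l *\<^sub>R (y - x))"
      using h(2) by (auto simp: subdiff_iff blinfun.bilinear_simps)
    moreover have "x + l *\<^sub>R (y - x) = (1 - l) *\<^sub>R x + l *\<^sub>R y" by (simp add: algebra_simps)
    ultimately show ?thesis by (simp add: subdiff_inv_def)
  qed (use x in simp)
qed

text \<open>
  On the convex set \<open>subdiff_inv H xs\<close> the function \<open>H\<close> differs from \<open>xs\<close> by a constant, which strict
  convexity excludes as soon as there are two points: at the midpoint \<open>H\<close> would drop below the supporting
  affine function.
\<close>

lemma strictly_convex_subdiff_inv_unique:
  assumes conv: "econvex_on UNIV H"
    and strict: "\<And>C. \<lbrakk>convex C; C \<subseteq> setmap_dom (subdiff H)\<rbrakk> \<Longrightarrow> strictly_econvex_on C H"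
    and xs: "xs \<in> subdiff H x" "xs \<in> subdiff H y"
  shows "x = y"
proof (rule ccontr)
  assume "x \<noteq> y"
  obtain h where h: "H x = ereal h" "\<And>u. ereal (h + xs (u - x)) \<le> H u"
    using xs(1) by (auto simp: subdiff_iff)
  obtain k where k: "H y = ereal k" "\<And>u. ereal (k + xs (u - y)) \<le> H u"
    using xs(2) by (auto simp: subdiff_iff)
  have "strictly_econvex_on (subdiff_inv H xs) H"
    by (rule strict[OF convex_subdiff_inv[OF conv]]) (auto simp: subdiff_inv_def setmap_dom_def)
  moreover have "x \<in> subdiff_inv H xs" "y \<in> subdiff_inv H xs" using xs by (auto simp: subdiff_inv_def)
  ultimately have "H ((1/2) *\<^sub>R x + (1/2) *\<^sub>R y) < ereal (1/2) * H x + ereal (1/2) * H y"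
    using \<open>x \<noteq> y\<close> unfolding strictly_econvex_on_def by auto
  then have up: "H ((1/2) *\<^sub>R x + (1/2) *\<^sub>R y) < ereal ((h + k) / 2)" using h(1) k(1) by (simp add: add_divide_distrib)
  have "ereal (h + xs ((1/2) *\<^sub>R x + (1/2) *\<^sub>R y - x)) < ereal ((h + k) / 2)"
    using h(2) up by (rule le_less_trans)
  then show False
    using k(2)[of x] h(2)[of y] h(1) k(1) by (simp add: blinfun.bilinear_simps)
qed

text \<open>
  By uniqueness the gap is positive away from \<open>x\<close>; compact spheres make this uniform in each radius.
\<close>

lemma strictly_convex_finite_dim_imp_firm:
  fixes H :: "'a::real_normed_vector \<Rightarrow> ereal"
  assumes H: "H \<in> Gamma_funs"
    and strict: "\<And>C. \<lbrakk>convex C; C \<subseteq> setmap_dom (subdiff H)\<rbrakk> \<Longrightarrow> strictly_econvex_on C H"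
    and B: "finite (B :: 'a set)" "span B = UNIV"
    and xs: "xs \<in> subdiff H x"
  shows "\<exists>\<psi>\<in>Gamma0. firm_subgradient_ineq H x xs \<psi>"
proof -
  have conv: "econvex_on UNIV H" and lsc: "lsc_on UNIV H"
    using H by (auto simp: Gamma_funs_def)
  obtain h where h: "H x = ereal h" and sub: "\<And>u. ereal (h + xs (u - x)) \<le> H u"
    using xs by (auto simp: subdiff_iff)
  have less: "ereal (h + xs (u - x)) < H u" if "u \<noteq> x" for u
  proof (rule ccontr)
    assume "\<not> ereal (h + xs (u - x)) < H u"
    then have "H u = ereal (h + xs (u - x))" using sub[of u] by (simp add: antisym)
    then have "xs \<in> subdiff H u" using sub by (auto simp: subdiff_iff blinfun.diff_right)
    then have "u = x"
      by (intro strictly_convex_subdiff_inv_unique[OF conv _ _ xs] strict)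
    then show False using that by simp
  qed
  show ?thesis
  proof (rule firm_if_gap_positive_on_spheres[OF conv xs])
    fix s :: real assume s: "0 < s"
    have "\<exists>c>0. \<forall>u\<in>sphere x s. ereal (h + xs (u - x) + c) \<le> H u"
    proof (rule strict_minorant_gap_on_compact[OF lsc _ compact_sphere_finite_dim[OF B]])
      show "continuous_on UNIV (\<lambda>u. h + xs (u - x))" by (intro continuous_intros)
      fix u assume "u \<in> sphere x s"
      then have "u \<noteq> x" using s by auto
      then show "ereal (h + xs (u - x)) < H u" by (rule less)
    qed
    then obtain c where c: "0 < c" "\<And>u. u \<in> sphere x s \<Longrightarrow> ereal (h + xs (u - x) + c) \<le> H u"
      by blast
    have "H x + ereal (xs (u - x)) + ereal c \<le> H u" if "norm (u - x) = s" for u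
      using c(2)[of u] that by (simp add: h dist_norm norm_minus_commute)
    with c(1) show "\<exists>c>0. \<forall>u. norm (u - x) = s \<longrightarrow> H x + ereal (xs (u - x)) + ereal c \<le> H u"
      by blast
  qed
qed

section \<open>The implications\<close>

theorem proposition6:
  fixes H :: "'a::banach \<Rightarrow> ereal"
  assumes "H \<in> Gamma_funs"
  shows "((\<forall>x \<in> setmap_dom (subdiff H). totally_convex_at H x) \<longrightarrow> ess_firmly_subdifferentiable H)
       \<and> (ess_firmly_subdifferentiable H \<longrightarrow> ess_strongly_convex H)
       \<and> (ess_strongly_convex H \<longrightarrow> ess_strictly_convex H)
       \<and> ((\<exists>B :: 'a set. finite B \<and> span B = UNIV) \<longrightarrow>
            ess_strictly_convex H \<longrightarrow> ess_firmly_subdifferentiable H)"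
proof (intro conjI impI)
  have ess_firm_iff: "ess_firmly_subdifferentiable H \<longleftrightarrow>
      (\<forall>x xs. xs \<in> subdiff H x \<longrightarrow> (\<exists>\<psi>\<in>Gamma0. firm_subgradient_ineq H x xs \<psi>))"
    using assms unfolding ess_firmly_subdifferentiable_def Gamma_funs_def setmap_dom_def by blast
  show "ess_firmly_subdifferentiable H" if "\<forall>x \<in> setmap_dom (subdiff H). totally_convex_at H x"
    unfolding ess_firm_iff using that totally_convex_imp_firm by (fastforce simp: setmap_dom_def)
  show "ess_strongly_convex H" if "ess_firmly_subdifferentiable H"
  proof -
    have firm: "\<And>x xs. xs \<in> subdiff H x \<Longrightarrow> \<exists>\<psi>\<in>Gamma0. firm_subgradient_ineq H x xs \<psi>"
      using that unfolding ess_firm_iff by blast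
    then have some: "\<exists>xs\<in>subdiff H x. \<exists>\<psi>\<in>Gamma0. firm_subgradient_ineq H x xs \<psi>"
      if "x \<in> setmap_dom (subdiff H)" for x
      using that unfolding setmap_dom_def by blast
    then have "strictly_econvex_on C H" if "convex C" "C \<subseteq> setmap_dom (subdiff H)" for C
      using that by (intro firm_imp_strictly_convex) auto
    then have "ess_strictly_convex H"
      using assms firm_imp_subdiff_inv_locally_bounded[OF firm] unfolding ess_strictly_convex_def by blast
    then show ?thesis using assms some unfolding ess_strongly_convex_def by blast
  qed
  show "ess_strictly_convex H" if "ess_strongly_convex H"
    using that by (simp add: ess_strongly_convex_def)
  show "ess_firmly_subdifferentiable H"
    if "\<exists>B :: 'a set. finite B \<and> span B = UNIV" "ess_strictly_convex H"
    unfolding ess_firm_iff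
    using that strictly_convex_finite_dim_imp_firm[OF assms] unfolding ess_strictly_convex_def by blast
qed

end
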